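(* Assume that the inverse gamma function satisfies the expansion $$\Gamma^{-1}(x)=u_0(x)+\frac12+O\Big(\frac{1}{u_0(x)\,w(x)}\Big),\qquad x\to\infty,$$ where $w(x):=W\big(\log(x/\sqrt{2\pi})/e\big)$ and $u_0(x):=\log(x/\sqrt{2\pi})/w(x)$. Let $\alpha,\beta>0$, $\mu\ge0$ with $\alpha-\beta(\mu+1)<0$, and let $0<d_1<d_2<1$. For $r>0$ put $$S^!_{\alpha,\beta,\mu}(r):=\sum_{n=0}^\infty\frac{(n!)^\alpha}{\big((n!)^\beta+r^2\big)^{\mu+1}}.$$ Then $$S^!_{\alpha,\beta,\mu}(r)=r^{-2(\mu+1-\alpha/\beta)}\exp\big(-m(r)\log\log r+O(\log\log\log r)\big)$$ as $r\to\infty$ in the set $$\mathcal R:=\big\{r>0: d_1\le\{\Gamma^{-1}(r^{2/\beta})\}\le d_2\big\},$$ where $$m(r):=\min\Big\{\alpha\{\Gamma^{-1}(r^{2/\beta})\},\ \big(\beta(\mu+1)-\alpha\big)\big(1-\{\Gamma^{-1}(r^{2/\beta})\}\big)\Big\},$$ which is $>0$ for $r\in\mathcal R$.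
   Context: $\{x\}$ denotes the fractional part of a real number $x$. $\Gamma^{-1}$ denotes the functional inverse of the gamma function on its increasing branch (so that $\Gamma^{-1}(x)\to\infty$ as $x\to\infty$); only large $r$ matter. $W$ is the (principal branch of the) Lambert function, satisfying $W(z)e^{W(z)}=z$. *)

theory Defs
  imports "HOL-Analysis.Analysis" "HOL-Library.Landau_Symbols"
begin

(* The points of the positive half-line from which on Gamma is strictly increasing, that is,
   the ray [c, infinity) where c = 1.46... is the minimum point of Gamma on (0, infinity). *)
definition Gamma_increasing_branch :: "real set" where
  "Gamma_increasing_branch = {y. y > 0 \<and> strict_mono_on {y..} (Gamma :: real \<Rightarrow> real)}"

(* Meaningful only on the image of the increasing branch, which contains all sufficiently
   large x; unspecified elsewhere. *)
definition inv_Gamma :: "real \<Rightarrow> real" where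
  "inv_Gamma = the_inv_into Gamma_increasing_branch Gamma"

(* The principal real branch takes values in [-1, infinity); meaningful for z >= -1/e. *)
definition Lambert_W :: "real \<Rightarrow> real" where
  "Lambert_W = the_inv_into {-1..} (\<lambda>w. w * exp w)"

definition w_aux :: "real \<Rightarrow> real" where
  "w_aux x = Lambert_W (ln (x / sqrt (2 * pi)) / exp 1)"

definition u0_aux :: "real \<Rightarrow> real" where
  "u0_aux x = ln (x / sqrt (2 * pi)) / w_aux x"

definition S_fact :: "real \<Rightarrow> real \<Rightarrow> real \<Rightarrow> real \<Rightarrow> real" where
  "S_fact \<alpha> \<beta> \<mu> r =
     (\<Sum>n. (fact n) powr \<alpha> / ((fact n) powr \<beta> + r\<^sup>2) powr (\<mu> + 1))"

definition frac_inv_Gamma :: "real \<Rightarrow> real \<Rightarrow> real" where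
  "frac_inv_Gamma \<beta> r = frac (inv_Gamma (r powr (2 / \<beta>)))"

definition R_set :: "real \<Rightarrow> real \<Rightarrow> real \<Rightarrow> real set" where
  "R_set \<beta> d1 d2 = {r. r > 0 \<and> d1 \<le> frac_inv_Gamma \<beta> r \<and> frac_inv_Gamma \<beta> r \<le> d2}"

definition m_fun :: "real \<Rightarrow> real \<Rightarrow> real \<Rightarrow> real \<Rightarrow> real" where
  "m_fun \<alpha> \<beta> \<mu> r =
     min (\<alpha> * frac_inv_Gamma \<beta> r) ((\<beta> * (\<mu> + 1) - \<alpha>) * (1 - frac_inv_Gamma \<beta> r))"

lemma inj_on_Gamma_increasing_branch: "inj_on Gamma Gamma_increasing_branch"
proof (rule inj_onI)
  fix x y :: real
  assume *: "x \<in> Gamma_increasing_branch" "y \<in> Gamma_increasing_branch" "Gamma x = Gamma y"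
  have "Gamma a < Gamma b" if "a \<in> Gamma_increasing_branch" "a < b" for a b :: real
    using that by (auto simp: Gamma_increasing_branch_def strict_mono_on_def)
  with * show "x = y"
    by (metis less_irrefl linorder_neqE_linordered_idom)
qed

lemma strict_mono_on_times_exp: "strict_mono_on {-1..} (\<lambda>w::real. w * exp w)"
proof (rule strict_mono_onI)
  fix x y :: real
  assume "x \<in> {-1..}" and xy: "x < y"
  hence x: "-1 \<le> x" by simp
  show "x * exp x < y * exp y"
  proof (rule DERIV_pos_imp_increasing_open[OF xy])
    fix t assume t: "x < t" "t < y"
    have "((\<lambda>w. w * exp w) has_real_derivative exp t * (1 + t)) (at t)"
      by (auto intro!: derivative_eq_intros simp: algebra_simps)
    moreover have "exp t * (1 + t) > 0"
      using t x by simp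
    ultimately show "\<exists>z. ((\<lambda>w. w * exp w) has_real_derivative z) (at t) \<and> 0 < z"
      by blast
  qed (intro continuous_intros)
qed

lemma Lambert_W_eq: "-1 \<le> w \<Longrightarrow> Lambert_W (w * exp w) = w"
  unfolding Lambert_W_def
  using the_inv_into_f_f[OF strict_mono_on_imp_inj_on[OF strict_mono_on_times_exp], of w] by simp

lemma summable_S_fact:
  fixes \<alpha> \<beta> \<mu> r :: real
  assumes "\<mu> \<ge> 0" "\<alpha> - \<beta> * (\<mu> + 1) < 0"
  shows "summable (\<lambda>n. (fact n :: real) powr \<alpha> / ((fact n) powr \<beta> + r\<^sup>2) powr (\<mu> + 1))"
proof -
  define c where "c = \<beta> * (\<mu> + 1) - \<alpha>"
  have c: "c > 0" using assms by (simp add: c_def)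
  have two: "2 ^ n \<le> 2 * (fact n :: real)" for n
  proof (induction n)
    case (Suc n)
    show ?case
    proof (cases "n = 0")
      case False
      have "2 * 2 ^ n \<le> 2 * (2 * (fact n :: real))" using Suc by simp
      also have "\<dots> \<le> 2 * (real (Suc n) * fact n)"
        using False by (intro mult_left_mono mult_right_mono) auto
      finally show ?thesis by simp
    qed simp
  qed simp
  have "summable (\<lambda>n. 2 powr c * (2 powr (-c)) ^ n)"
    using c by (intro summable_mult summable_geometric) (simp add: powr_less_one)
  moreover have "norm ((fact n :: real) powr \<alpha> / ((fact n) powr \<beta> + r\<^sup>2) powr (\<mu> + 1))
      \<le> 2 powr c * (2 powr (-c)) ^ n" for n
  proof -
    have pos: "(fact n :: real) powr \<beta> > 0" "(fact n :: real) powr \<beta> + r\<^sup>2 > 0"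
      by (auto intro: add_pos_nonneg)
    have "((fact n :: real) powr \<beta>) powr (\<mu> + 1) \<le> ((fact n) powr \<beta> + r\<^sup>2) powr (\<mu> + 1)"
      using assms(1) by (intro powr_mono2) auto
    hence "(fact n :: real) powr \<alpha> / ((fact n) powr \<beta> + r\<^sup>2) powr (\<mu> + 1)
        \<le> (fact n :: real) powr \<alpha> / ((fact n) powr \<beta>) powr (\<mu> + 1)"
      using pos by (intro divide_left_mono mult_pos_pos) (auto simp: powr_gt_zero)
    also have "\<dots> = (fact n :: real) powr (\<alpha> - \<beta> * (\<mu> + 1))"
      by (simp only: powr_powr powr_diff)
    also have "\<alpha> - \<beta> * (\<mu> + 1) = - c"
      by (simp add: c_def)
    also have "(fact n :: real) powr (- c) \<le> (2 ^ n / 2) powr (- c)"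
      using c two[of n] by (intro powr_mono2') auto
    also have "\<dots> = 2 powr c * (2 powr (- c)) ^ n"
    proof -
      have a: "(2 powr (- c)) ^ n = 2 powr (- c * real n)"
        by (simp only: powr_powr powr_gt_zero flip: powr_realpow)
      have b: "2 ^ n / 2 = (2::real) powr (real n - 1)"
        unfolding powr_diff by (simp add: powr_realpow)
      have "(real n - 1) * (- c) = c + (- c * real n)" by (simp add: algebra_simps)
      then show ?thesis unfolding a b powr_powr by (simp only: powr_add)
    qed
    finally show ?thesis by simp
  qed
  ultimately show ?thesis by (rule summable_comparison_test'[where N = 0])
qed

end

theory Submission
  imports Defs "HOL-Real_Asymp.Real_Asymp"
begin

text \<open>
  Put \<open>X = r powr (2 / \<beta>) = \<Gamma>(N + d)\<close> with \<open>N\<close> a natural number and \<open>0 \<le> d < 1\<close>, and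
  \<open>c = \<beta> (\<mu> + 1) - \<alpha>\<close>. After division by \<open>X powr (- c)\<close>, the terms of the series grow at least
  geometrically up to \<open>n = N - 1\<close> and decay at least geometrically from \<open>n = N\<close> on, so the
  sum is comparable to \<open>((N - 1)! / X) powr \<alpha> + (X / N!) powr c\<close>. Log-convexity of \<open>\<Gamma>\<close> turns these
  two terms into \<open>N powr (- \<alpha> d)\<close> and \<open>N powr (- c (1 - d))\<close> up to constant factors, hence the
  sum is \<open>N powr (- m)\<close> up to a constant factor. Finally \<open>ln N = ln (ln r) + O(ln (ln (ln r)))\<close>,
  which follows from the crude bounds \<open>N / 4 \<le> ln X \<le> N ln N\<close>.
\<close>

section \<open>Growth of Gamma under shifts and its inverse on the increasing branch\<close>

text \<open>Log-convexity of Gamma, applied to \<open>x + s\<close> as the convex combination of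
  \<open>x\<close> and \<open>x + 1\<close> with weights \<open>1 - s\<close> and \<open>s\<close>;
  the functional equation removes \<open>Gamma (x + 1)\<close>.\<close>

lemma Gamma_real_shift_le:
  fixes x s :: real
  assumes "x > 0" "0 \<le> s" "s \<le> 1"
  shows "Gamma (x + s) \<le> x powr s * Gamma x"
proof -
  have "(ln \<circ> Gamma) ((1 - s) *\<^sub>R x + s *\<^sub>R (x + 1))
      \<le> (1 - s) * (ln \<circ> Gamma) x + s * (ln \<circ> Gamma) (x + 1)"
    using assms by (intro convex_onD[OF log_convex_Gamma_real]) auto
  moreover have "(1 - s) *\<^sub>R x + s *\<^sub>R (x + 1) = x + s"
    by (simp add: algebra_simps)
  moreover have "Gamma (x + 1) = x * Gamma x"
    using assms by (intro Gamma_plus1) (auto elim!: nonpos_Ints_cases)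
  ultimately have "ln (Gamma (x + s)) \<le> s * ln x + ln (Gamma x)"
    using assms Gamma_real_pos[of x] by (simp add: ln_mult_pos algebra_simps)
  hence "exp (ln (Gamma (x + s))) \<le> exp (s * ln x + ln (Gamma x))"
    by simp
  thus ?thesis
    using assms Gamma_real_pos[of x] Gamma_real_pos[of "x + s"] by (simp add: exp_add powr_def)
qed

text \<open>This follows from the upper bound, applied to the remaining shift by
  \<open>1 - s\<close> from \<open>x + s\<close> to \<open>x + 1\<close>. The factor 2 absorbs the
  replacement of \<open>x + s\<close> by \<open>2 * x\<close>, which is possible since
  \<open>x \<ge> 1\<close>.\<close>

lemma Gamma_real_shift_ge:
  fixes x s :: real
  assumes "x \<ge> 1" "0 \<le> s" "s \<le> 1"
  shows "x powr s * Gamma x \<le> 2 * Gamma (x + s)"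
proof -
  have pos: "Gamma (x + s) > 0"
    using assms by (intro Gamma_real_pos) auto
  have "x * Gamma x = Gamma (x + 1)"
    using assms by (intro Gamma_plus1[symmetric]) (auto elim!: nonpos_Ints_cases)
  also have "\<dots> = Gamma ((x + s) + (1 - s))" by simp
  also have "\<dots> \<le> (x + s) powr (1 - s) * Gamma (x + s)"
    using assms by (intro Gamma_real_shift_le) auto
  also have "(x + s) powr (1 - s) \<le> (2 * x) powr (1 - s)"
    using assms by (intro powr_mono2) auto
  also have "\<dots> = 2 powr (1 - s) * x powr (1 - s)"
    using assms by (simp add: powr_mult)
  also have "2 powr (1 - s) \<le> (2::real) powr 1"
    using assms by (intro powr_mono) auto
  finally have "x * Gamma x \<le> 2 * x powr (1 - s) * Gamma (x + s)"
    using pos by (simp add: mult_right_mono)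
  moreover have "x = x powr (1 - s) * x powr s"
    using assms by (simp flip: powr_add)
  ultimately have "x powr (1 - s) * (x powr s * Gamma x) \<le> x powr (1 - s) * (2 * Gamma (x + s))"
    by (metis mult.assoc mult.commute)
  thus ?thesis
    using assms by (subst (asm) mult_le_cancel_left_pos) auto
qed

text \<open>The bound 3/2 is a convenient point to the right of the minimum point 1.46... of Gamma,
  where \<open>Gamma_real_strict_mono\<close> applies.\<close>

lemma inv_Gamma_Gamma:
  assumes "y \<ge> 3 / 2"
  shows "inv_Gamma (Gamma y) = y"
proof -
  have "y \<in> Gamma_increasing_branch"
    using assms by (auto simp: Gamma_increasing_branch_def
        intro!: strict_mono_onI Gamma_real_strict_mono)
  thus ?thesis
    unfolding inv_Gamma_def by (intro the_inv_into_f_f inj_on_Gamma_increasing_branch)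
qed

lemma Gamma_real_surj_large:
  fixes X K :: real
  assumes "K \<ge> 3 / 2" "X \<ge> Gamma K"
  obtains y where "y \<ge> K" "Gamma y = X"
proof -
  \<comment> \<open>The right end point for the intermediate value theorem is \<open>n + 1\<close>,
    because \<open>Gamma (n + 1) = n! \<ge> n \<ge> X\<close>.\<close>
  define n where "n = nat \<lceil>max K X\<rceil> + 1"
  have n: "real n \<ge> K" "real n \<ge> X"
    unfolding n_def by linarith+
  have "real n \<le> fact n"
    using fact_ge_self[of n] by (metis of_nat_fact of_nat_le_iff)
  also have "fact n = Gamma (real n + 1)"
    by (simp add: Gamma_fact add.commute)
  finally have "X \<le> Gamma (real n + 1)"
    using n by linarith
  moreover have "continuous_on {K..real n + 1} (Gamma :: real \<Rightarrow> real)"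
    using assms by (intro continuous_intros) (auto elim!: nonpos_Ints_cases)
  ultimately obtain y where "K \<le> y" "y \<le> real n + 1" "Gamma y = X"
    using IVT'[of Gamma K X "real n + 1"] assms n by auto
  thus ?thesis using that by blast
qed

section \<open>Factorial growth and the normalised terms of the series\<close>

text \<open>Passing from \<open>k!\<close> to \<open>n!\<close> multiplies by factors that are all
  at least 2, except for the factor 1 when \<open>k = 0\<close>; the 2 on the right pays for that
  one.\<close>

lemma power2_mult_fact_le:
  assumes "k \<le> n"
  shows "2 ^ (n - k) * fact k \<le> 2 * (fact n :: real)"
  using assms
proof (induction n rule: dec_induct)
  case (step n)
  show ?case
  proof (cases "n = 0")
    case False
    have "2 ^ (Suc n - k) * fact k = 2 * (2 ^ (n - k) * (fact k :: real))"
      using step by (simp add: Suc_diff_le)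
    also have "\<dots> \<le> real (Suc n) * (2 * fact n)"
      using False by (intro mult_mono step.IH) auto
    finally show ?thesis by simp
  qed (use step in simp)
qed simp

text \<open>Up to the factor \<open>X powr (\<beta> * (\<mu> + 1) - \<alpha>)\<close>, where \<open>X = r powr (2 / \<beta>)\<close>,
  the \<open>n\<close>-th term of the series is \<open>\<phi> (n! / X)\<close>.\<close>

definition \<phi> :: "real \<Rightarrow> real \<Rightarrow> real \<Rightarrow> real \<Rightarrow> real" where
  "\<phi> \<alpha> \<beta> \<mu> t = t powr \<alpha> / (t powr \<beta> + 1) powr (\<mu> + 1)"

lemma \<phi>_eq:
  assumes "f > 0" "X > 0"
  shows "f powr \<alpha> / (f powr \<beta> + X powr \<beta>) powr (\<mu> + 1) =
           X powr (- (\<beta> * (\<mu> + 1) - \<alpha>)) * \<phi> \<alpha> \<beta> \<mu> (f / X)"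
proof -
  have "f powr \<beta> + X powr \<beta> = X powr \<beta> * ((f / X) powr \<beta> + 1)"
    using assms by (simp add: powr_divide field_simps)
  hence "(f powr \<beta> + X powr \<beta>) powr (\<mu> + 1) =
      X powr (\<beta> * (\<mu> + 1)) * ((f / X) powr \<beta> + 1) powr (\<mu> + 1)"
    by (simp add: powr_mult powr_powr)
  moreover have "f powr \<alpha> = X powr \<alpha> * (f / X) powr \<alpha>"
    using assms by (simp add: powr_divide)
  moreover have "(f / X) powr \<beta> + 1 > 0"
    by (simp add: add_nonneg_pos)
  ultimately show ?thesis
    using assms by (simp add: \<phi>_def powr_diff)
qed

lemma \<phi>_nonneg: "0 \<le> \<phi> \<alpha> \<beta> \<mu> t"
  by (simp add: \<phi>_def)

text \<open>In the denominator \<open>t powr \<beta> + 1\<close> either summand may be dropped,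
  which gives the two upper bounds for every \<open>t > 0\<close>. The larger summand is 1 for
  \<open>t \<le> 1\<close> and \<open>t powr \<beta>\<close> for \<open>t \<ge> 1\<close>; doubling
  it gives the lower bounds.\<close>

lemma \<phi>_bounds:
  fixes \<alpha> \<beta> \<mu> t :: real
  assumes "t > 0" "\<mu> \<ge> 0" "\<beta> > 0"
  defines "c \<equiv> \<beta> * (\<mu> + 1) - \<alpha>"
  shows \<phi>_le_left: "\<phi> \<alpha> \<beta> \<mu> t \<le> t powr \<alpha>"
    and \<phi>_le_right: "\<phi> \<alpha> \<beta> \<mu> t \<le> (1 / t) powr c"
    and \<phi>_ge_left: "t \<le> 1 \<Longrightarrow> t powr \<alpha> / 2 powr (\<mu> + 1) \<le> \<phi> \<alpha> \<beta> \<mu> t"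
    and \<phi>_ge_right: "t \<ge> 1 \<Longrightarrow> (1 / t) powr c / 2 powr (\<mu> + 1) \<le> \<phi> \<alpha> \<beta> \<mu> t"
proof -
  have pos: "t powr \<beta> > 0" using assms by simp
  have t: "(1 / t) powr c = t powr \<alpha> / (t powr \<beta>) powr (\<mu> + 1)"
    using assms by (simp add: c_def powr_divide powr_powr powr_diff)
  have "t powr \<beta> + 1 > 0" using pos by linarith
  hence D: "(t powr \<beta> + 1) powr (\<mu> + 1) > 0" by simp
  have "1 powr (\<mu> + 1) \<le> (t powr \<beta> + 1) powr (\<mu> + 1)"
    using assms by (intro powr_mono2) auto
  thus "\<phi> \<alpha> \<beta> \<mu> t \<le> t powr \<alpha>"
    unfolding \<phi>_def using D by (simp add: divide_le_eq mult_le_cancel_left1)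
  have "(t powr \<beta>) powr (\<mu> + 1) \<le> (t powr \<beta> + 1) powr (\<mu> + 1)"
    using assms by (intro powr_mono2) auto
  thus "\<phi> \<alpha> \<beta> \<mu> t \<le> (1 / t) powr c"
    unfolding \<phi>_def t using assms D by (intro divide_left_mono) auto
  show "t powr \<alpha> / 2 powr (\<mu> + 1) \<le> \<phi> \<alpha> \<beta> \<mu> t" if "t \<le> 1"
  proof -
    have "t powr \<beta> \<le> 1 powr \<beta>"
      using assms that by (intro powr_mono2) auto
    hence "(t powr \<beta> + 1) powr (\<mu> + 1) \<le> 2 powr (\<mu> + 1)"
      using assms by (intro powr_mono2) auto
    thus ?thesis unfolding \<phi>_def using D by (intro divide_left_mono) auto
  qed
  show "(1 / t) powr c / 2 powr (\<mu> + 1) \<le> \<phi> \<alpha> \<beta> \<mu> t" if "t \<ge> 1"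
  proof -
    have "1 powr \<beta> \<le> t powr \<beta>"
      using assms that by (intro powr_mono2) auto
    hence "(t powr \<beta> + 1) powr (\<mu> + 1) \<le> (2 * t powr \<beta>) powr (\<mu> + 1)"
      using assms by (intro powr_mono2) auto
    also have "\<dots> = (t powr \<beta>) powr (\<mu> + 1) * 2 powr (\<mu> + 1)"
      by (simp add: powr_mult)
    finally show ?thesis
      unfolding \<phi>_def t divide_divide_eq_left using D assms by (intro divide_left_mono) auto
  qed
qed

lemma sum_power_diff_le:
  fixes q :: real
  assumes "0 \<le> q" "q < 1"
  shows "(\<Sum>n<Suc m. q ^ (m - n)) \<le> 1 / (1 - q)"
proof -
  have "(\<Sum>n<Suc m. q ^ (m - n)) = (\<Sum>n<Suc m. q ^ n)"
    using sum.nat_diff_reindex[of "\<lambda>n. q ^ n" "Suc m"] by simp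
  also have "\<dots> \<le> (\<Sum>n. q ^ n)"
    using assms by (intro sum_le_suminf summable_geometric) auto
  also have "\<dots> = 1 / (1 - q)"
    using assms by (intro suminf_geometric) auto
  finally show ?thesis .
qed

lemma powr_two_power: "(2 / 2 ^ k) powr a = 2 powr a * (2 powr (- a)) ^ k" for a :: real
proof -
  have "2 / 2 ^ k = (2::real) powr (1 - real k)"
    by (simp add: powr_diff powr_realpow)
  thus ?thesis
    by (simp add: powr_powr powr_add[symmetric] algebra_simps flip: powr_realpow)
qed

section \<open>Two-sided estimates for the normalised series\<close>

context
  fixes \<alpha> \<beta> \<mu> c :: real
  assumes \<alpha>: "\<alpha> > 0" and \<beta>: "\<beta> > 0" and \<mu>: "\<mu> \<ge> 0" and c: "c > 0"
    and c_eq: "c = \<beta> * (\<mu> + 1) - \<alpha>"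
begin

lemma S_fact_eq_suminf_\<phi>:
  assumes "X > 0" "r > 0" "X = r powr (2 / \<beta>)"
  shows "summable (\<lambda>n. \<phi> \<alpha> \<beta> \<mu> (fact n / X))"
    and "S_fact \<alpha> \<beta> \<mu> r = X powr (- c) * (\<Sum>n. \<phi> \<alpha> \<beta> \<mu> (fact n / X))"
proof -
  have r: "r\<^sup>2 = X powr \<beta>"
    using assms \<beta> by (simp add: powr_powr powr_numeral)
  have eq: "fact n powr \<alpha> / (fact n powr \<beta> + r\<^sup>2) powr (\<mu> + 1) =
      X powr (- c) * \<phi> \<alpha> \<beta> \<mu> (fact n / X)" for n
    unfolding r c_eq using assms by (intro \<phi>_eq) auto
  have "summable (\<lambda>n. X powr (- c) * \<phi> \<alpha> \<beta> \<mu> (fact n / X))"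
    unfolding eq[symmetric] using \<mu> c c_eq by (intro summable_S_fact) auto
  thus *: "summable (\<lambda>n. \<phi> \<alpha> \<beta> \<mu> (fact n / X))"
    using assms by (subst (asm) summable_cmult_iff) auto
  show "S_fact \<alpha> \<beta> \<mu> r = X powr (- c) * (\<Sum>n. \<phi> \<alpha> \<beta> \<mu> (fact n / X))"
    unfolding S_fact_def eq by (rule suminf_mult[OF *])
qed

text \<open>The series is cut after \<open>n = M\<close>. The terms up to \<open>M\<close> are
  compared with \<open>(M! / X) powr \<alpha>\<close> and the later ones with
  \<open>(X / (M + 1)!) powr c\<close>; by \<open>power2_mult_fact_le\<close> both comparisons lose
  a geometric factor with each step away from the cut.\<close>

lemma suminf_\<phi>_le:
  assumes X: "X > 0" and sm: "summable (\<lambda>n. \<phi> \<alpha> \<beta> \<mu> (fact n / X))"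
  shows "(\<Sum>n. \<phi> \<alpha> \<beta> \<mu> (fact n / X)) \<le>
           2 powr \<alpha> / (1 - 2 powr (- \<alpha>)) * (fact M / X) powr \<alpha> +
           2 powr c / (1 - 2 powr (- c)) * (X / fact (Suc M)) powr c"
proof -
  let ?f = "\<lambda>n. \<phi> \<alpha> \<beta> \<mu> (fact n / X)"
  define A where "A = (fact M / X) powr \<alpha> * 2 powr \<alpha>"
  define B where "B = (X / fact (Suc M)) powr c * 2 powr c"
  have q: "2 powr (- \<alpha>) < 1" "2 powr (- c) < 1"
    using \<alpha> c by (simp_all add: powr_less_one)
  have low: "?f n \<le> A * (2 powr (- \<alpha>)) ^ (M - n)" if "n < Suc M" for n
  proof -
    have "?f n \<le> (fact n / X) powr \<alpha>"
      using X \<mu> \<beta> by (intro \<phi>_le_left) auto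
    also have "\<dots> \<le> (fact M / X * (2 / 2 ^ (M - n))) powr \<alpha>"
      using power2_mult_fact_le[of n M] that X \<alpha> by (intro powr_mono2) (auto simp: field_simps)
    also have "\<dots> = A * (2 powr (- \<alpha>)) ^ (M - n)"
      using X unfolding A_def by (subst powr_mult) (simp_all only: powr_two_power mult.assoc)
    finally show ?thesis .
  qed
  have high: "?f (n + Suc M) \<le> B * (2 powr (- c)) ^ n" for n
  proof -
    have "?f (n + Suc M) \<le> (1 / (fact (n + Suc M) / X)) powr c"
      unfolding c_eq using X \<mu> \<beta> by (intro \<phi>_le_right) auto
    also have "\<dots> \<le> (X / fact (Suc M) * (2 / 2 ^ n)) powr c"
      using power2_mult_fact_le[of "Suc M" "n + Suc M"] X c
      by (intro powr_mono2) (auto simp: field_simps simp del: fact_Suc)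
    also have "\<dots> = B * (2 powr (- c)) ^ n"
      using X unfolding B_def by (subst powr_mult) (simp_all only: powr_two_power mult.assoc)
    finally show ?thesis .
  qed
  have "(\<Sum>n. ?f n) = (\<Sum>n. ?f (n + Suc M)) + (\<Sum>n<Suc M. ?f n)"
    by (rule suminf_split_initial_segment[OF sm])
  also have "(\<Sum>n. ?f (n + Suc M)) \<le> (\<Sum>n. B * (2 powr (- c)) ^ n)"
    using q high by (intro suminf_le summable_mult summable_geometric
        summable_ignore_initial_segment[OF sm]) auto
  also have "\<dots> = B * (1 / (1 - 2 powr (- c)))"
    using q by (subst suminf_mult) (auto intro!: summable_geometric simp: suminf_geometric)
  also have "(\<Sum>n<Suc M. ?f n) \<le> (\<Sum>n<Suc M. A * (2 powr (- \<alpha>)) ^ (M - n))"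
    using low by (intro sum_mono) auto
  also have "\<dots> = A * (\<Sum>n<Suc M. (2 powr (- \<alpha>)) ^ (M - n))"
    by (simp only: sum_distrib_left)
  also have "\<dots> \<le> A * (1 / (1 - 2 powr (- \<alpha>)))"
    using q by (intro mult_left_mono sum_power_diff_le) (auto simp: A_def)
  finally show ?thesis
    by (simp add: A_def B_def mult_ac add_ac)
qed

text \<open>All terms are nonnegative, so the single terms \<open>n = M\<close> and
  \<open>n = M + 1\<close> suffice; the bracketing of \<open>X\<close> puts their arguments on
  either side of 1.\<close>

lemma suminf_\<phi>_ge:
  assumes X: "X > 0" and sm: "summable (\<lambda>n. \<phi> \<alpha> \<beta> \<mu> (fact n / X))"
    and M: "fact M \<le> X" "X \<le> fact (Suc M)"
  shows "(fact M / X) powr \<alpha> / 2 powr (\<mu> + 1) \<le> (\<Sum>n. \<phi> \<alpha> \<beta> \<mu> (fact n / X))"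
    and "(X / fact (Suc M)) powr c / 2 powr (\<mu> + 1) \<le> (\<Sum>n. \<phi> \<alpha> \<beta> \<mu> (fact n / X))"
proof -
  have le: "\<phi> \<alpha> \<beta> \<mu> (fact k / X) \<le> (\<Sum>n. \<phi> \<alpha> \<beta> \<mu> (fact n / X))" for k
    using sum_le_suminf[OF sm, of "{k}"] by (simp add: \<phi>_nonneg)
  show "(fact M / X) powr \<alpha> / 2 powr (\<mu> + 1) \<le> (\<Sum>n. \<phi> \<alpha> \<beta> \<mu> (fact n / X))"
    using \<mu> \<beta> X M by (intro order.trans[OF \<phi>_ge_left le]) auto
  have "(X / fact (Suc M)) powr c = (1 / (fact (Suc M) / X)) powr c"
    by simp
  also have "\<dots> / 2 powr (\<mu> + 1) \<le> (\<Sum>n. \<phi> \<alpha> \<beta> \<mu> (fact n / X))"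
    unfolding c_eq using \<mu> \<beta> X M
    by (intro order.trans[OF \<phi>_ge_right le]) (auto simp del: fact_Suc)
  finally show "(X / fact (Suc M)) powr c / 2 powr (\<mu> + 1) \<le> (\<Sum>n. \<phi> \<alpha> \<beta> \<mu> (fact n / X))" .
qed

text \<open>The point is that \<open>K\<close> is uniform in \<open>M\<close>, \<open>d\<close> and
  \<open>X\<close>. With \<open>N = M + 1\<close>, the quotients \<open>M! / X\<close> and
  \<open>X / (M + 1)!\<close> are \<open>N powr (- d)\<close> and \<open>N powr (- (1 - d))\<close>
  up to a factor 2, and the larger of the resulting two powers is
  \<open>N powr (- m)\<close>.\<close>

lemma suminf_\<phi>_asymp:
  "\<exists>K. \<forall>M d X. M \<ge> 1 \<and> 0 \<le> d \<and> d \<le> 1 \<and> X = Gamma (real (Suc M) + d) \<and>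
     summable (\<lambda>n. \<phi> \<alpha> \<beta> \<mu> (fact n / X)) \<longrightarrow>
       (\<Sum>n. \<phi> \<alpha> \<beta> \<mu> (fact n / X)) > 0 \<and>
       \<bar>ln (\<Sum>n. \<phi> \<alpha> \<beta> \<mu> (fact n / X)) + min (\<alpha> * d) (c * (1 - d)) * ln (real (Suc M))\<bar> \<le> K"
proof -
  \<comment> \<open>\<open>2 powr (\<mu> + 1)\<close> is the loss in the lower bounds for
    \<open>\<phi>\<close>; \<open>2 powr (- c)\<close> comes from the factor 1/2 in the lower bound
    for \<open>X / (M + 1)!\<close>.\<close>
  define K1 where "K1 = 2 powr (- c) / 2 powr (\<mu> + 1)"
  define P where "P = 2 powr \<alpha> / (1 - 2 powr (- \<alpha>))"
  define Q where "Q = 2 powr c / (1 - 2 powr (- c))"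
  \<comment> \<open>\<open>P\<close> and \<open>Q\<close> are the geometric series constants of
    \<open>suminf_\<phi>_le\<close>; the extra \<open>2 powr \<alpha>\<close> comes from the factor
    2 in the upper bound for \<open>M! / X\<close>.\<close>
  define K2 where "K2 = P * 2 powr \<alpha> + Q"
  have "2 powr (- \<alpha>) < 1" "2 powr (- c) < 1"
    using \<alpha> c by (simp_all add: powr_less_one)
  hence P: "P > 0" and Q: "Q > 0"
    by (simp_all add: P_def Q_def)
  have K1: "K1 > 0" by (simp add: K1_def)
  have K2: "K2 > 0" using P Q by (simp add: K2_def add_pos_pos)
  show ?thesis
  proof (intro exI[of _ "\<bar>ln K1\<bar> + \<bar>ln K2\<bar>"] allI impI, elim conjE)
    fix M :: nat and d X :: real
    assume M: "M \<ge> 1" and d: "0 \<le> d" "d \<le> 1" and X_eq: "X = Gamma (real (Suc M) + d)"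
      and sm: "summable (\<lambda>n. \<phi> \<alpha> \<beta> \<mu> (fact n / X))"
    define N where "N = real (Suc M)"
    define m where "m = min (\<alpha> * d) (c * (1 - d))"
    define T where "T = (\<Sum>n. \<phi> \<alpha> \<beta> \<mu> (fact n / X))"
    have N: "N \<ge> 2" using M by (simp add: N_def)
    have X: "X > 0" unfolding X_eq using d by (intro Gamma_real_pos) auto
    have G: "Gamma N = fact M"
      using Gamma_fact[of M, where 'a = real] by (simp add: N_def add.commute)
    have G1: "Gamma (N + 1) = fact (Suc M)"
      using Gamma_fact[of "Suc M", where 'a = real] by (simp add: N_def add.commute)
    have fS: "fact (Suc M) = N * fact M" by (simp add: N_def)
    have X_ge: "fact M \<le> X"
      using Gamma_real_strict_mono[of N "N + d"] N d G X_eq by (cases "d = 0") (auto simp: N_def)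
    have X_le: "X \<le> fact (Suc M)"
      using Gamma_real_strict_mono[of "N + d" "N + 1"] N d G1 X_eq
      by (cases "d = 1") (auto simp: N_def simp del: fact_Suc)
    have up: "X \<le> N powr d * fact M"
      using Gamma_real_shift_le[of N d] N d G by (simp add: X_eq N_def)
    have lo: "N powr d * fact M \<le> 2 * X"
      using Gamma_real_shift_ge[of N d] N d G by (simp add: X_eq N_def)
    have left: "N powr (- d) \<le> fact M / X" "fact M / X \<le> 2 * N powr (- d)"
      using up lo X N by (simp_all add: powr_minus field_simps)
    have right: "N powr (- (1 - d)) / 2 \<le> X / fact (Suc M)" "X / fact (Suc M) \<le> N powr (- (1 - d))"
    proof -
      define w where "w = N powr (- (1 - d))"
      have "N powr d = N * w"
        using N by (simp add: w_def powr_diff)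
      thus "N powr (- (1 - d)) / 2 \<le> X / fact (Suc M)" "X / fact (Suc M) \<le> N powr (- (1 - d))"
        unfolding fS w_def[symmetric] using up lo X N by (simp_all add: field_simps)
    qed
    have m1: "N powr (- (\<alpha> * d)) \<le> N powr (- m)" "N powr (- (c * (1 - d))) \<le> N powr (- m)"
      using N by (auto simp: m_def intro!: powr_mono)
    have "T \<le> P * (fact M / X) powr \<alpha> + Q * (X / fact (Suc M)) powr c"
      unfolding T_def P_def Q_def by (rule suminf_\<phi>_le[OF X sm])
    also have "\<dots> \<le> P * (2 * N powr (- d)) powr \<alpha> + Q * (N powr (- (1 - d))) powr c"
      using P Q left right X \<alpha> c
      by (intro add_mono mult_left_mono powr_mono2) (auto simp del: fact_Suc)
    also have "\<dots> = P * 2 powr \<alpha> * N powr (- (\<alpha> * d)) + Q * N powr (- (c * (1 - d)))"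
      by (simp add: powr_mult powr_powr algebra_simps)
    also have "\<dots> \<le> P * 2 powr \<alpha> * N powr (- m) + Q * N powr (- m)"
      using P Q m1 by (intro add_mono mult_left_mono) auto
    finally have TU: "T \<le> K2 * N powr (- m)"
      by (simp add: K2_def algebra_simps)
    have TL: "K1 * N powr (- m) \<le> T"
    \<comment> \<open>The term kept for the lower bound is the one whose exponent attains the
      minimum \<open>m\<close>: \<open>n = M\<close> in the first case, \<open>n = M + 1\<close> in
      the second.\<close>
    proof (cases "\<alpha> * d \<le> c * (1 - d)")
      case True
      have "2 powr (- c) \<le> (2::real) powr 0"
        using c by (intro powr_mono) auto
      hence "K1 * N powr (- m) \<le> N powr (- m) / 2 powr (\<mu> + 1)"
        by (simp add: K1_def divide_right_mono mult_left_le_one_le)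
      also have "\<dots> = (N powr (- d)) powr \<alpha> / 2 powr (\<mu> + 1)"
        using True by (simp add: m_def powr_powr mult_ac)
      also have "\<dots> \<le> (fact M / X) powr \<alpha> / 2 powr (\<mu> + 1)"
        using left \<alpha> by (intro divide_right_mono powr_mono2) auto
      also have "\<dots> \<le> T"
        unfolding T_def by (rule suminf_\<phi>_ge[OF X sm X_ge X_le])
      finally show ?thesis .
    next
      case False
      have "K1 * N powr (- m) = (N powr (- (1 - d)) / 2) powr c / 2 powr (\<mu> + 1)"
        using False by (simp add: K1_def m_def powr_divide powr_powr powr_minus field_simps)
      also have "\<dots> \<le> (X / fact (Suc M)) powr c / 2 powr (\<mu> + 1)"
        using right c by (intro divide_right_mono powr_mono2) (auto simp del: fact_Suc)
      also have "\<dots> \<le> T"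
        unfolding T_def by (rule suminf_\<phi>_ge[OF X sm X_ge X_le])
      finally show ?thesis .
    qed
    have T: "T > 0"
      using TL K1 N by (smt (verit) mult_pos_pos powr_gt_zero)
    have "ln (K1 * N powr (- m)) \<le> ln T"
      using TL K1 N T by (subst ln_le_cancel_iff) auto
    hence l: "ln K1 - m * ln N \<le> ln T"
      using K1 N by (simp add: ln_mult_pos ln_powr)
    have "ln T \<le> ln (K2 * N powr (- m))"
      using TU K2 N T by (subst ln_le_cancel_iff) auto
    hence u: "ln T \<le> ln K2 - m * ln N"
      using K2 N by (simp add: ln_mult_pos ln_powr)
    have "\<bar>ln T + m * ln N\<bar> \<le> \<bar>ln K1\<bar> + \<bar>ln K2\<bar>"
      using l u by linarith
    with T show "(\<Sum>n. \<phi> \<alpha> \<beta> \<mu> (fact n / X)) > 0 \<and>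
       \<bar>ln (\<Sum>n. \<phi> \<alpha> \<beta> \<mu> (fact n / X)) + min (\<alpha> * d) (c * (1 - d)) * ln (real (Suc M))\<bar>
         \<le> \<bar>ln K1\<bar> + \<bar>ln K2\<bar>"
      by (simp only: T_def m_def N_def)
  qed
qed

end

section \<open>Comparison of the logarithm of N with the iterated logarithm of X\<close>

text \<open>With \<open>N = M + 1\<close> and \<open>L = ln X\<close>, the bound
  \<open>2 ^ M \<le> 2 * M!\<close> gives \<open>N \<le> 4 * L\<close>, and
  \<open>(M + 1)! \<le> N ^ N\<close> gives \<open>L \<le> N * ln N\<close>. Taking logarithms
  leaves an error \<open>ln (ln N)\<close>, which the first bound turns into
  \<open>ln (ln L)\<close> plus a constant.\<close>

lemma ln_ln_between_fact:
  assumes "M \<ge> 3" "fact M \<le> X" "X \<le> fact (Suc M)" "ln (ln X) \<ge> ln 4"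
  shows "\<bar>ln (real (Suc M)) - ln (ln X)\<bar> \<le> ln (ln (ln X)) + ln 4"
proof -
  define N where "N = real (Suc M)"
  define L where "L = ln X"
  have ln2: "ln 2 \<ge> (2 / 3 :: real)" by (rule ln2_ge_two_thirds)
  have ln4: "ln (4::real) = 2 * ln 2"
    using ln_powr[of 2 "2::real"] by simp
  have X: "X > 0" using assms(2) by (meson fact_gt_zero less_le_trans)
  have "2 ^ M \<le> 2 * (fact M :: real)"
    using power2_mult_fact_le[of 0 M] by simp
  hence "2 ^ M \<le> 2 * X" using assms by linarith
  hence "ln (2 ^ M) \<le> ln (2 * X)"
    using X by (subst ln_le_cancel_iff) auto
  hence "(real M - 1) * ln 2 \<le> L"
    using X by (simp add: L_def ln_mult_pos ln_realpow algebra_simps)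
  moreover have "(real M - 1) * (1 / 2) \<le> (real M - 1) * ln 2"
    using assms ln2 by (intro mult_left_mono) auto
  ultimately have "(real M - 1) * (1 / 2) \<le> L" by linarith
  hence "real M - 1 \<le> 2 * L" by simp
  moreover have "real M \<ge> 3" using assms(1) by simp
  ultimately have NL: "N \<le> 4 * L"
    unfolding N_def of_nat_Suc by linarith
  have N: "N \<ge> 4" using assms by (simp add: N_def)
  have L: "L > 0" using NL N by linarith
  have "ln N \<le> ln (4 * L)"
    using NL N L by (subst ln_le_cancel_iff) auto
  hence 1: "ln N \<le> ln 4 + ln L"
    using L by (simp add: ln_mult_pos)
  have "ln L \<ge> ln 4" using assms(4) by (simp add: L_def)
  \<comment> \<open>The assumption \<open>ln L \<ge> ln 4\<close> absorbs the additive constant, so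
    that \<open>ln (ln N)\<close> can be bounded by \<open>ln 2 + ln (ln L)\<close> below.\<close>
  hence le: "ln N \<le> 2 * ln L" and pos: "2 * ln L > 0"
    using 1 ln4 ln2 by linarith+
  have "X \<le> N ^ Suc M"
    using assms(3) fact_le_power[of "Suc M", where 'a = real] unfolding N_def
    by (metis of_nat_power order_trans)
  hence "L \<le> ln (N ^ Suc M)"
    unfolding L_def using X N by (subst ln_le_cancel_iff) auto
  also have "\<dots> = N * ln N"
    using ln_realpow[of N "Suc M"] N by (simp only: N_def)
  finally have "ln L \<le> ln (N * ln N)"
    using L N by (subst ln_le_cancel_iff) auto
  also have "\<dots> = ln N + ln (ln N)"
    using N by (intro ln_mult_pos) auto
  also have "ln (ln N) \<le> ln (2 * ln L)"
    using le pos N by (subst ln_le_cancel_iff) (simp, assumption+)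
  also have "\<dots> = ln 2 + ln (ln L)"
    using assms(4) ln2 ln4 by (intro ln_mult_pos) (auto simp: L_def)
  finally have 2: "ln L \<le> ln N + (ln 2 + ln (ln L))" by simp
  \<comment> \<open>Since \<open>ln 4 = 2 * ln 2 \<ge> 4/3\<close>, also
    \<open>ln L \<ge> 1\<close>. Thus the one-sided bound \<open>ln N - ln L \<le> ln 4\<close> fits
    under the symmetric bound.\<close>
  have "ln (ln L) \<ge> 0"
    using assms(4) ln2 ln4 by (intro ln_ge_zero) (simp add: L_def)
  with 1 2 show ?thesis
    using ln2 ln4 by (simp add: N_def L_def)
qed

section \<open>Assembly of the asymptotic formula\<close>

theorem theorem1p3:
  fixes \<alpha> \<beta> \<mu> d1 d2 :: real
  assumes inv_Gamma_expansion:
      "(\<lambda>x. inv_Gamma x - (u0_aux x + 1 / 2)) \<in> O[at_top](\<lambda>x. 1 / (u0_aux x * w_aux x))"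
    and "\<alpha> > 0" and "\<beta> > 0" and "\<mu> \<ge> 0"
    and "\<alpha> - \<beta> * (\<mu> + 1) < 0"
    and "0 < d1" and "d1 < d2" and "d2 < 1"
  shows "(\<exists>E. E \<in> O[inf at_top (principal (R_set \<beta> d1 d2))](\<lambda>r. ln (ln (ln r))) \<and>
           (\<forall>\<^sub>F r in inf at_top (principal (R_set \<beta> d1 d2)).
              S_fact \<alpha> \<beta> \<mu> r =
                r powr (- 2 * (\<mu> + 1 - \<alpha> / \<beta>)) *
                exp (- m_fun \<alpha> \<beta> \<mu> r * ln (ln r) + E r)))
         \<and> (\<forall>r \<in> R_set \<beta> d1 d2. m_fun \<alpha> \<beta> \<mu> r > 0)"
proof -
  define c where "c = \<beta> * (\<mu> + 1) - \<alpha>"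
  have c: "c > 0" using assms by (simp add: c_def)
  note ctxt = \<open>\<alpha> > 0\<close> \<open>\<beta> > 0\<close> \<open>\<mu> \<ge> 0\<close> c c_def
  obtain K where K: "\<And>M d X. M \<ge> 1 \<Longrightarrow> 0 \<le> d \<Longrightarrow> d \<le> 1 \<Longrightarrow> X = Gamma (real (Suc M) + d) \<Longrightarrow>
     summable (\<lambda>n. \<phi> \<alpha> \<beta> \<mu> (fact n / X)) \<Longrightarrow>
       (\<Sum>n. \<phi> \<alpha> \<beta> \<mu> (fact n / X)) > 0 \<and>
       \<bar>ln (\<Sum>n. \<phi> \<alpha> \<beta> \<mu> (fact n / X)) + min (\<alpha> * d) (c * (1 - d)) * ln (real (Suc M))\<bar> \<le> K"
    using suminf_\<phi>_asymp[OF ctxt] by blast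
  define A where "A r = r powr (- 2 * (\<mu> + 1 - \<alpha> / \<beta>))" for r
  \<comment> \<open>\<open>E\<close> is the exact logarithmic error, so the claimed equation is an
    identity as soon as the sum is positive; what remains is to bound \<open>E\<close>.\<close>
  define E where "E r = ln (S_fact \<alpha> \<beta> \<mu> r / A r) + m_fun \<alpha> \<beta> \<mu> r * ln (ln r)" for r
  \<comment> \<open>Explicit majorant of \<open>E\<close>: \<open>K\<close> is the error for the
    sum, and \<open>\<alpha>\<close> bounds \<open>m_fun\<close>, which multiplies the cost of
    replacing \<open>ln N\<close> by \<open>ln (ln r)\<close>. The constant
    \<open>\<bar>ln (2 / \<beta>)\<bar>\<close> arises from
    \<open>ln (ln X) = ln (2 / \<beta>) + ln (ln r)\<close>.\<close>
  define B where "B r = \<bar>K\<bar> + \<alpha> * (ln (ln (2 / \<beta> * ln r)) + ln 4 + \<bar>ln (2 / \<beta>)\<bar>)" for r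
  \<comment> \<open>The threshold \<open>Gamma 4\<close> makes the preimage \<open>y\<close> at
    least 4, hence \<open>M \<ge> 3\<close> as \<open>ln_ln_between_fact\<close> requires.\<close>
  have "\<forall>\<^sub>F r in at_top. r powr (2 / \<beta>) \<ge> Gamma 4"
    using \<open>\<beta> > 0\<close> by real_asymp
  moreover have "\<forall>\<^sub>F r in at_top. ln (2 / \<beta> * ln r) \<ge> ln 4"
    using \<open>\<beta> > 0\<close> by real_asymp
  ultimately have main: "\<forall>\<^sub>F r in at_top. S_fact \<alpha> \<beta> \<mu> r > 0 \<and> \<bar>E r\<bar> \<le> B r"
    using eventually_gt_at_top[of 1]
  proof eventually_elim
    case (elim r)
    define X where "X = r powr (2 / \<beta>)"
    have lnX: "ln X = 2 / \<beta> * ln r"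
      using elim by (simp add: X_def ln_powr)
    have X: "X > 0" using elim by (simp add: X_def)
    obtain y where y: "y \<ge> 4" "Gamma y = X"
      using Gamma_real_surj_large[of 4 X] elim by (auto simp: X_def)
    define d where "d = frac y"
    \<comment> \<open>The shift by one makes \<open>Suc M\<close> the integer part of
      \<open>y\<close>, so that \<open>Gamma (real (Suc M)) = M!\<close> and \<open>X\<close> lies
      between \<open>M!\<close> and \<open>(M + 1)!\<close>.\<close>
    define M where "M = nat \<lfloor>y\<rfloor> - 1"
    have fl: "\<lfloor>y\<rfloor> \<ge> 4" using y by linarith
    have M: "M \<ge> 3" using fl unfolding M_def by linarith
    have SM: "real (Suc M) = of_int \<lfloor>y\<rfloor>"
      using fl by (simp add: M_def)
    have yd: "y = real (Suc M) + d"
      unfolding SM d_def frac_def by simp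
    have d: "0 \<le> d" "d < 1"
      by (simp_all add: d_def frac_lt_1)
    have fr: "frac_inv_Gamma \<beta> r = d"
      using inv_Gamma_Gamma[of y] y by (simp add: frac_inv_Gamma_def X_def d_def)
    have m: "m_fun \<alpha> \<beta> \<mu> r = min (\<alpha> * d) (c * (1 - d))"
      by (simp add: m_fun_def fr c_def)
    have m_le: "0 \<le> m_fun \<alpha> \<beta> \<mu> r" "m_fun \<alpha> \<beta> \<mu> r \<le> \<alpha>"
      unfolding m using d \<open>\<alpha> > 0\<close> c by (auto simp: min_le_iff_disj mult_left_le)
    have "fact M = Gamma (real (Suc M))"
      using Gamma_fact[of M, where 'a = real] by (simp add: add.commute)
    also have "\<dots> \<le> X"
      using Gamma_real_strict_mono[of "real (Suc M)" y] M d yd y by (cases "d = 0") auto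
    finally have X_ge: "fact M \<le> X" .
    have "X \<le> Gamma (real (Suc M) + 1)"
      using Gamma_real_strict_mono[of y "real (Suc M) + 1"] M d yd y by auto
    also have "\<dots> = fact (Suc M)"
      using Gamma_fact[of "Suc M", where 'a = real] by (simp add: add.commute)
    finally have X_le: "X \<le> fact (Suc M)" .
    define T where "T = (\<Sum>n. \<phi> \<alpha> \<beta> \<mu> (fact n / X))"
    have r: "r > 0" using elim by simp
    note S = S_fact_eq_suminf_\<phi>[OF ctxt X r X_def]
    have T: "T > 0" "\<bar>ln T + m_fun \<alpha> \<beta> \<mu> r * ln (real (Suc M))\<bar> \<le> K"
      using K[of M d X, OF _ _ _ _ S(1)] M d y yd unfolding m T_def by auto
    \<comment> \<open>The exponents agree because
      \<open>2 * (\<mu> + 1 - \<alpha> / \<beta>) = (2 / \<beta>) * c\<close>.\<close>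
    have A: "A r = X powr (- c)"
      using \<open>\<beta> > 0\<close> by (simp add: A_def X_def powr_powr c_def field_simps)
    have ST: "S_fact \<alpha> \<beta> \<mu> r = A r * T"
      unfolding A T_def by (rule S(2))
    have A0: "A r > 0" using X by (simp add: A)
    have "ln (ln X) = ln (2 / \<beta>) + ln (ln r)"
      unfolding lnX using elim \<open>\<beta> > 0\<close> by (intro ln_mult_pos) auto
    moreover have "\<bar>ln (real (Suc M)) - ln (ln X)\<bar> \<le> ln (ln (ln X)) + ln 4"
      using elim by (intro ln_ln_between_fact M X_ge X_le) (simp add: lnX)
    ultimately have *: "\<bar>ln (ln r) - ln (real (Suc M))\<bar> \<le> ln (ln (ln X)) + ln 4 + \<bar>ln (2 / \<beta>)\<bar>"
      by linarith
    have "E r = (ln T + m_fun \<alpha> \<beta> \<mu> r * ln (real (Suc M))) +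
        m_fun \<alpha> \<beta> \<mu> r * (ln (ln r) - ln (real (Suc M)))"
      using A0 by (simp add: E_def ST algebra_simps)
    also have "\<bar>\<dots>\<bar> \<le> \<bar>ln T + m_fun \<alpha> \<beta> \<mu> r * ln (real (Suc M))\<bar> +
        m_fun \<alpha> \<beta> \<mu> r * \<bar>ln (ln r) - ln (real (Suc M))\<bar>"
      using m_le by (intro order.trans[OF abs_triangle_ineq]) (simp add: abs_mult)
    also have "\<dots> \<le> \<bar>K\<bar> + \<alpha> * (ln (ln (ln X)) + ln 4 + \<bar>ln (2 / \<beta>)\<bar>)"
      using T * m_le by (intro add_mono mult_mono) auto
    finally show ?case
      using A0 T by (simp add: ST B_def lnX)
  qed
  have "E \<in> O(B)"
    using main by (intro landau_o.big_mono) (auto elim!: eventually_mono)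
  also have "B \<in> O(\<lambda>r. ln (ln (ln r)))"
    unfolding B_def using \<open>\<beta> > 0\<close> \<open>\<alpha> > 0\<close> by real_asymp
  \<comment> \<open>The estimate along \<open>at_top\<close> passes to the finer filter that also
    restricts \<open>r\<close> to \<open>R_set\<close>.\<close>
  finally have "E \<in> O[inf at_top (principal (R_set \<beta> d1 d2))](\<lambda>r. ln (ln (ln r)))"
    by (rule landau_o.big.filter_mono[rotated]) simp
  moreover have "\<forall>\<^sub>F r in at_top. S_fact \<alpha> \<beta> \<mu> r =
      A r * exp (- m_fun \<alpha> \<beta> \<mu> r * ln (ln r) + E r)"
    using main eventually_gt_at_top[of 0]
  proof eventually_elim
    case (elim r)
    thus ?case by (simp add: E_def A_def)
  qed
  hence "\<forall>\<^sub>F r in inf at_top (principal (R_set \<beta> d1 d2)). S_fact \<alpha> \<beta> \<mu> r =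
      r powr (- 2 * (\<mu> + 1 - \<alpha> / \<beta>)) * exp (- m_fun \<alpha> \<beta> \<mu> r * ln (ln r) + E r)"
    unfolding A_def by (rule filter_leD[rotated]) simp
  \<comment> \<open>On this set the fractional part is at least \<open>d1 > 0\<close> and its
    complement to 1 at least \<open>1 - d2 > 0\<close>, so both arguments of the minimum are
    positive.\<close>
  moreover have "\<forall>r \<in> R_set \<beta> d1 d2. m_fun \<alpha> \<beta> \<mu> r > 0"
    using assms by (auto simp: R_set_def m_fun_def)
  ultimately show ?thesis by blast
qed

end
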